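(* Let $P:\mathcal{A}\to\mathcal{X}$ be an order-solid ordered functor between ordered categories, and let $\mathcal{D}$ be an ordered category. If $\mathcal{X}$ has weighted colimits of shape $\mathcal{D}$, then so does $\mathcal{A}$.
   Context: $\mathcal{P}os$ is the category of partially ordered sets and monotone maps. An ordered category is a category whose hom-sets carry a partial order preserved by composition from either side; an ordered functor is a functor whose hom-maps are monotone. $\mathcal{P}os$ is ordered by the pointwise order of maps. $\mathcal{D}^{\mathrm{op}}$ reverses arrows but keeps their order. An ordered diagram of shape $\mathcal{D}$ in $\mathcal{A}$ is an ordered functor $D:\mathcal{D}\to\mathcal{A}$, where $\mathcal{D}$ is an ordered category of unrestricted size. A weight is an ordered functor $W:\mathcal{D}^{\mathrm{op}}\to\mathcal{P}os$. A $W$-weighted cocone $\alpha:D\to A$ is a family of morphisms $\alpha_i^u:Di\to A$ ($i\in\mathrm{ob}\,\mathcal{D}$, $u\in Wi$) with $\alpha_i^u\le\alpha_i^v$ whenever $u\le v$ in $Wi$, and $\alpha_j^v\cdot Dd=\alpha_i^{Wd(v)}$ for all $d:i\to j$ in $\mathcal{D}$, $v\in Wj$. Equalities and inequalities involving cocones are meant componentwise. A $W$-weighted colimit of $D$ is a $W$-weighted cocone $\alpha:D\to A$ such that every $W$-weighted cocone $\beta:D\to B$ is $\beta=t\cdot\alpha$ for a unique $t:A\to B$, and $\alpha$ is order-epic: $r\cdot\alpha\le s\cdot\alpha$ implies $r\le s$ for all $r,s:A\to B$. A category has weighted colimits of shape $\mathcal{D}$ if these exist for all ordered diagrams of shape $\mathcal{D}$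 and all weights $W:\mathcal{D}^{\mathrm{op}}\to\mathcal{P}os$. Order-universal $P$-extension of a $W$-weighted cocone $\xi:PD\to X$ in $\mathcal{X}$ (with $D:\mathcal{D}\to\mathcal{A}$): a triple $(\alpha,A,q)$ with a $W$-weighted cocone $\alpha:D\to A$ in $\mathcal{A}$ and $q:X\to PA$ such that: 1. $q\cdot\xi=P\alpha$; 2. for every $W$-weighted cocone $\beta:D\to B$ in $\mathcal{A}$ and $f:X\to PB$ with $f\cdot\xi=P\beta$ there is a (unique) $t:A\to B$ with $t\cdot\alpha=\beta$ and $Pt\cdot q=f$; 3. for all $r,s:A\to B$ in $\mathcal{A}$, if $Pr\cdot q\le Ps\cdot q$ and $r\cdot\alpha\le s\cdot\alpha$, then $r\le s$. $P$ is order-solid if every weighted cocone $\xi:PD\to X$, for every ordered diagram $D$ in $\mathcal{A}$ of any shape and any weight, has an order-universal $P$-extension. *)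

theory Defs
  imports "HOL-Library.FuncSet"
begin

section \<open>Ordered categories and ordered functors\<close>

text \<open>Composition is written in applicative order. Only the restriction of the order
  to each hom-set is meaningful; its values on non-parallel arrows are irrelevant.\<close>

record ('o, 'a) ocat =
  Obj :: "'o set"
  Arr :: "'a set"
  src :: "'a \<Rightarrow> 'o"
  tgt :: "'a \<Rightarrow> 'o"
  idn :: "'o \<Rightarrow> 'a"
  cmp :: "'a \<Rightarrow> 'a \<Rightarrow> 'a" (infixr \<open>\<cdot>\<index>\<close> 70)
  leq :: "'a \<Rightarrow> 'a \<Rightarrow> bool" (infix \<open>\<preceq>\<index>\<close> 50)

definition hom :: "('o, 'a) ocat \<Rightarrow> 'o \<Rightarrow> 'o \<Rightarrow> 'a set" where
  "hom C a b = {f \<in> Arr C. src C f = a \<and> tgt C f = b}"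

locale ordered_category =
  fixes C :: "('o, 'a) ocat" (structure)
  assumes src_Obj: "f \<in> Arr C \<Longrightarrow> src C f \<in> Obj C"
    and tgt_Obj: "f \<in> Arr C \<Longrightarrow> tgt C f \<in> Obj C"
    and idn_hom: "a \<in> Obj C \<Longrightarrow> idn C a \<in> hom C a a"
    and cmp_hom: "\<lbrakk>f \<in> hom C a b; g \<in> hom C b c\<rbrakk> \<Longrightarrow> g \<cdot> f \<in> hom C a c"
    and idn_left: "f \<in> hom C a b \<Longrightarrow> idn C b \<cdot> f = f"
    and idn_right: "f \<in> hom C a b \<Longrightarrow> f \<cdot> idn C a = f"
    and cmp_assoc: "\<lbrakk>f \<in> hom C a b; g \<in> hom C b c; h \<in> hom C c d\<rbrakk>
      \<Longrightarrow> (h \<cdot> g) \<cdot> f = h \<cdot> (g \<cdot> f)"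
    and leq_refl: "reflp_on (hom C a b) (leq C)"
    and leq_trans: "transp_on (hom C a b) (leq C)"
    and leq_antisym: "antisymp_on (hom C a b) (leq C)"
    and cmp_mono_left: "\<lbrakk>f \<in> hom C a b; f' \<in> hom C a b; g \<in> hom C b c; f \<preceq> f'\<rbrakk>
      \<Longrightarrow> g \<cdot> f \<preceq> g \<cdot> f'"
    and cmp_mono_right: "\<lbrakk>f \<in> hom C a b; g \<in> hom C b c; g' \<in> hom C b c; g \<preceq> g'\<rbrakk>
      \<Longrightarrow> g \<cdot> f \<preceq> g' \<cdot> f"

definition opp :: "('o, 'a) ocat \<Rightarrow> ('o, 'a) ocat" where
  "opp C = \<lparr>Obj = Obj C, Arr = Arr C, src = tgt C, tgt = src C, idn = idn C,
    cmp = (\<lambda>g f. cmp C f g), leq = leq C\<rparr>"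

record ('o, 'a, 'p, 'b) fctr =
  ob :: "'o \<Rightarrow> 'p"
  mor :: "'a \<Rightarrow> 'b"

locale ordered_functor =
  dom: ordered_category C + cod: ordered_category E
  for C :: "('o, 'a) ocat" and E :: "('p, 'b) ocat" +
  fixes F :: "('o, 'a, 'p, 'b) fctr"
  assumes ob_Obj: "a \<in> Obj C \<Longrightarrow> ob F a \<in> Obj E"
    and mor_hom: "f \<in> hom C a b \<Longrightarrow> mor F f \<in> hom E (ob F a) (ob F b)"
    and mor_idn: "a \<in> Obj C \<Longrightarrow> mor F (idn C a) = idn E (ob F a)"
    and mor_cmp: "\<lbrakk>f \<in> hom C a b; g \<in> hom C b c\<rbrakk>
      \<Longrightarrow> mor F (g \<cdot>\<^bsub>C\<^esub> f) = mor F g \<cdot>\<^bsub>E\<^esub> mor F f"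
    and mor_mono: "\<lbrakk>f \<in> hom C a b; g \<in> hom C a b; f \<preceq>\<^bsub>C\<^esub> g\<rbrakk>
      \<Longrightarrow> mor F f \<preceq>\<^bsub>E\<^esub> mor F g"

definition fcomp :: "('p, 'b, 'q, 'c) fctr \<Rightarrow> ('o, 'a, 'p, 'b) fctr \<Rightarrow> ('o, 'a, 'q, 'c) fctr" where
  "fcomp G F = \<lparr>ob = (\<lambda>a. ob G (ob F a)), mor = (\<lambda>f. mor G (mor F f))\<rparr>"


section \<open>The ordered category of posets\<close>

text \<open>A poset with elements in \<open>'w\<close> is given by its order relation \<open>r\<close>, a set of pairs
  with \<open>Partial_order r\<close>; by reflexivity, its underlying set is \<open>Field r\<close>.
  A monotone map carries its domain and codomain, and its function is
  undefined outside the domain, so that equal morphisms are equal maps.\<close>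

record 'w pmap =
  psrc :: "'w rel"
  pfun :: "'w \<Rightarrow> 'w"
  ptgt :: "'w rel"

definition monotone_maps :: "'w pmap set" where
  "monotone_maps = {m. Partial_order (psrc m) \<and> Partial_order (ptgt m) \<and>
     pfun m \<in> Field (psrc m) \<rightarrow>\<^sub>E Field (ptgt m) \<and>
     (\<forall>(x, y) \<in> psrc m. (pfun m x, pfun m y) \<in> ptgt m)}"

definition Pos :: "('w rel, 'w pmap) ocat" where
  "Pos = \<lparr>Obj = {r. Partial_order r}, Arr = monotone_maps, src = psrc, tgt = ptgt,
    idn = (\<lambda>r. \<lparr>psrc = r, pfun = restrict id (Field r), ptgt = r\<rparr>),
    cmp = (\<lambda>n m. \<lparr>psrc = psrc m, pfun = compose (Field (psrc m)) (pfun n) (pfun m),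
                  ptgt = ptgt n\<rparr>),
    leq = (\<lambda>m n. \<forall>x \<in> Field (psrc m). (pfun m x, pfun n x) \<in> ptgt m)\<rparr>"


section \<open>Weighted cocones and weighted colimits\<close>

type_synonym ('i, 'd, 'w) weight = "('i, 'd, 'w rel, 'w pmap) fctr"

abbreviation is_weight :: "('i, 'd) ocat \<Rightarrow> ('i, 'd, 'w) weight \<Rightarrow> bool" where
  "is_weight \<D> W \<equiv> ordered_functor (opp \<D>) Pos W"

text \<open>The morphism \<open>\<alpha> i u\<close> is the component of the cocone at \<open>i\<close> and \<open>u\<close>. Its values
  outside \<open>i \<in> Obj \<D>\<close>, \<open>u \<in> Field (ob W i)\<close> are irrelevant, so cocones are compared
  through \<open>cocone_eq\<close> and \<open>cocone_leq\<close> below.\<close>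

definition weighted_cocone ::
  "('i, 'd) ocat \<Rightarrow> ('i, 'd, 'w) weight \<Rightarrow> ('o, 'a) ocat \<Rightarrow> ('i, 'd, 'o, 'a) fctr \<Rightarrow>
   ('i \<Rightarrow> 'w \<Rightarrow> 'a) \<Rightarrow> 'o \<Rightarrow> bool" where
  "weighted_cocone \<D> W \<A> D \<alpha> A \<longleftrightarrow>
     A \<in> Obj \<A> \<and>
     (\<forall>i \<in> Obj \<D>. \<forall>u \<in> Field (ob W i). \<alpha> i u \<in> hom \<A> (ob D i) A) \<and>
     (\<forall>i \<in> Obj \<D>. \<forall>(u, v) \<in> ob W i. \<alpha> i u \<preceq>\<^bsub>\<A>\<^esub> \<alpha> i v) \<and>
     (\<forall>i \<in> Obj \<D>. \<forall>j \<in> Obj \<D>. \<forall>d \<in> hom \<D> i j. \<forall>v \<in> Field (ob W j).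
        \<alpha> j v \<cdot>\<^bsub>\<A>\<^esub> mor D d = \<alpha> i (pfun (mor W d) v))"

definition cocone_eq ::
  "('i, 'd) ocat \<Rightarrow> ('i, 'd, 'w) weight \<Rightarrow> ('i \<Rightarrow> 'w \<Rightarrow> 'a) \<Rightarrow> ('i \<Rightarrow> 'w \<Rightarrow> 'a) \<Rightarrow> bool" where
  "cocone_eq \<D> W \<alpha> \<beta> \<longleftrightarrow> (\<forall>i \<in> Obj \<D>. \<forall>u \<in> Field (ob W i). \<alpha> i u = \<beta> i u)"

definition cocone_leq ::
  "('i, 'd) ocat \<Rightarrow> ('i, 'd, 'w) weight \<Rightarrow> ('o, 'a) ocat \<Rightarrow>
   ('i \<Rightarrow> 'w \<Rightarrow> 'a) \<Rightarrow> ('i \<Rightarrow> 'w \<Rightarrow> 'a) \<Rightarrow> bool" where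
  "cocone_leq \<D> W \<A> \<alpha> \<beta> \<longleftrightarrow>
     (\<forall>i \<in> Obj \<D>. \<forall>u \<in> Field (ob W i). \<alpha> i u \<preceq>\<^bsub>\<A>\<^esub> \<beta> i u)"

definition post :: "('o, 'a) ocat \<Rightarrow> 'a \<Rightarrow> ('i \<Rightarrow> 'w \<Rightarrow> 'a) \<Rightarrow> 'i \<Rightarrow> 'w \<Rightarrow> 'a" where
  "post \<A> t \<alpha> = (\<lambda>i u. t \<cdot>\<^bsub>\<A>\<^esub> \<alpha> i u)"

definition image_cocone :: "('o, 'a, 'p, 'b) fctr \<Rightarrow> ('i \<Rightarrow> 'w \<Rightarrow> 'a) \<Rightarrow> 'i \<Rightarrow> 'w \<Rightarrow> 'b" where
  "image_cocone P \<alpha> = (\<lambda>i u. mor P (\<alpha> i u))"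

definition weighted_colimit ::
  "('i, 'd) ocat \<Rightarrow> ('i, 'd, 'w) weight \<Rightarrow> ('o, 'a) ocat \<Rightarrow> ('i, 'd, 'o, 'a) fctr \<Rightarrow>
   ('i \<Rightarrow> 'w \<Rightarrow> 'a) \<Rightarrow> 'o \<Rightarrow> bool" where
  "weighted_colimit \<D> W \<A> D \<alpha> A \<longleftrightarrow>
     weighted_cocone \<D> W \<A> D \<alpha> A \<and>
     (\<forall>\<beta> B. weighted_cocone \<D> W \<A> D \<beta> B \<longrightarrow>
        (\<exists>!t. t \<in> hom \<A> A B \<and> cocone_eq \<D> W \<beta> (post \<A> t \<alpha>))) \<and>
     (\<forall>B \<in> Obj \<A>. \<forall>r \<in> hom \<A> A B. \<forall>s \<in> hom \<A> A B.
        cocone_leq \<D> W \<A> (post \<A> r \<alpha>) (post \<A> s \<alpha>) \<longrightarrow> r \<preceq>\<^bsub>\<A>\<^esub> s)"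

text \<open>HOL cannot quantify over types inside a formula. The types in which shapes have their
  objects and arrows, and weights their elements, are therefore parameters,
  passed as \<open>itself\<close> arguments where they do not occur otherwise. Being type variables,
  they can be instantiated arbitrarily, so sizes are not bounded.\<close>

definition has_weighted_colimits_of_shape ::
  "'w itself \<Rightarrow> ('i, 'd) ocat \<Rightarrow> ('o, 'a) ocat \<Rightarrow> bool" where
  "has_weighted_colimits_of_shape _ \<D> \<A> \<longleftrightarrow>
     (\<forall>D (W :: ('i, 'd, 'w) weight).
        ordered_functor \<D> \<A> D \<longrightarrow> is_weight \<D> W \<longrightarrow>
        (\<exists>\<alpha> A. weighted_colimit \<D> W \<A> D \<alpha> A))"


section \<open>Order-solid functors\<close>

definition order_universal_extension ::
  "('i, 'd) ocat \<Rightarrow> ('i, 'd, 'w) weight \<Rightarrow> ('o, 'a) ocat \<Rightarrow> ('p, 'b) ocat \<Rightarrow>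
   ('o, 'a, 'p, 'b) fctr \<Rightarrow> ('i, 'd, 'o, 'a) fctr \<Rightarrow> ('i \<Rightarrow> 'w \<Rightarrow> 'b) \<Rightarrow> 'p \<Rightarrow>
   ('i \<Rightarrow> 'w \<Rightarrow> 'a) \<Rightarrow> 'o \<Rightarrow> 'b \<Rightarrow> bool" where
  "order_universal_extension \<D> W \<A> \<X> P D \<xi> X \<alpha> A q \<longleftrightarrow>
     weighted_cocone \<D> W \<A> D \<alpha> A \<and>
     q \<in> hom \<X> X (ob P A) \<and>
     cocone_eq \<D> W (post \<X> q \<xi>) (image_cocone P \<alpha>) \<and>
     (\<forall>\<beta> B. \<forall>f \<in> hom \<X> X (ob P B).
        weighted_cocone \<D> W \<A> D \<beta> B \<longrightarrow>
        cocone_eq \<D> W (post \<X> f \<xi>) (image_cocone P \<beta>) \<longrightarrow>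
        (\<exists>!t. t \<in> hom \<A> A B \<and> cocone_eq \<D> W (post \<A> t \<alpha>) \<beta> \<and> mor P t \<cdot>\<^bsub>\<X>\<^esub> q = f)) \<and>
     (\<forall>B \<in> Obj \<A>. \<forall>r \<in> hom \<A> A B. \<forall>s \<in> hom \<A> A B.
        mor P r \<cdot>\<^bsub>\<X>\<^esub> q \<preceq>\<^bsub>\<X>\<^esub> mor P s \<cdot>\<^bsub>\<X>\<^esub> q \<longrightarrow>
        cocone_leq \<D> W \<A> (post \<A> r \<alpha>) (post \<A> s \<alpha>) \<longrightarrow> r \<preceq>\<^bsub>\<A>\<^esub> s)"

definition order_solid ::
  "'i itself \<Rightarrow> 'd itself \<Rightarrow> 'w itself \<Rightarrow>
   ('o, 'a) ocat \<Rightarrow> ('p, 'b) ocat \<Rightarrow> ('o, 'a, 'p, 'b) fctr \<Rightarrow> bool" where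
  "order_solid _ _ _ \<A> \<X> P \<longleftrightarrow>
     (\<forall>(\<D> :: ('i, 'd) ocat) (W :: ('i, 'd, 'w) weight) D \<xi> X.
        ordered_category \<D> \<longrightarrow> is_weight \<D> W \<longrightarrow> ordered_functor \<D> \<A> D \<longrightarrow>
        weighted_cocone \<D> W \<X> (fcomp P D) \<xi> X \<longrightarrow>
        (\<exists>\<alpha> A q. order_universal_extension \<D> W \<A> \<X> P D \<xi> X \<alpha> A q))"


section \<open>Well-definedness of the constructions\<close>

lemma ordered_category_opp:
  assumes "ordered_category C"
  shows "ordered_category (opp C)"
proof -
  interpret ordered_category C by fact
  have h: "hom (opp C) a b = hom C b a" for a b
    by (auto simp: hom_def opp_def)
  show ?thesis
    by unfold_locales
      (use src_Obj tgt_Obj idn_hom cmp_hom idn_left idn_right cmp_assoc leq_refl leq_trans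
        leq_antisym cmp_mono_left cmp_mono_right in \<open>auto simp: h, auto simp: opp_def\<close>)
qed

lemma Pos_sel:
  "Obj Pos = {r. Partial_order r}" "Arr Pos = monotone_maps" "src Pos = psrc" "tgt Pos = ptgt"
  "idn Pos r = \<lparr>psrc = r, pfun = restrict id (Field r), ptgt = r\<rparr>"
  "cmp Pos n m = \<lparr>psrc = psrc m, pfun = compose (Field (psrc m)) (pfun n) (pfun m), ptgt = ptgt n\<rparr>"
  "leq Pos m n \<longleftrightarrow> (\<forall>x \<in> Field (psrc m). (pfun m x, pfun n x) \<in> ptgt m)"
  by (simp_all add: Pos_def)

lemma hom_Pos_iff:
  "m \<in> hom Pos r s \<longleftrightarrow> Partial_order r \<and> Partial_order s \<and> psrc m = r \<and> ptgt m = s \<and>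
     pfun m \<in> Field r \<rightarrow>\<^sub>E Field s \<and> (\<forall>x y. (x, y) \<in> r \<longrightarrow> (pfun m x, pfun m y) \<in> s)"
  by (auto simp: hom_def Pos_sel(1-4) monotone_maps_def)

lemma ordered_category_Pos: "ordered_category (Pos :: ('w rel, 'w pmap) ocat)"
proof (unfold_locales, goal_cases)
  case (5 f a b)
  then have "pfun f x \<in> Field b" if "x \<in> Field a" for x
    using that by (auto simp: hom_Pos_iff)
  moreover have "pfun f x = undefined" if "x \<notin> Field a" for x
    using that 5 by (auto simp: hom_Pos_iff)
  ultimately show ?case
    using 5 by (auto simp: hom_Pos_iff Pos_sel compose_def fun_eq_iff intro!: pmap.equality)
next
  case (6 f a b)
  moreover have "pfun f x = undefined" if "x \<notin> Field a" for x
    using that 6 by (auto simp: hom_Pos_iff)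
  ultimately show ?case
    by (auto simp: hom_Pos_iff Pos_sel compose_def fun_eq_iff intro!: pmap.equality)
next
  case (7 f a b g c h d)
  then have "pfun f x \<in> Field b" if "x \<in> Field a" for x
    using that by (auto simp: hom_Pos_iff)
  with 7 show ?case
    by (auto simp: hom_Pos_iff Pos_sel compose_def fun_eq_iff)
next
  case (8 a b)
  then show ?case
    by (auto simp: hom_Pos_iff Pos_sel reflp_on_def order_on_defs refl_on_def dest!: PiE_mem)
next
  case (9 a b)
  then show ?case
    by (auto simp: hom_Pos_iff Pos_sel transp_on_def order_on_defs) (meson transD)
next
  case (10 a b)
  show ?case
  proof (rule antisymp_onI)
    fix x y :: "'w pmap"
    assume *: "x \<in> hom Pos a b" "y \<in> hom Pos a b" "leq Pos x y" "leq Pos y x"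
    then have "pfun x z = pfun y z" if "z \<in> Field a" for z
      using that by (auto simp: hom_Pos_iff Pos_sel order_on_defs dest: antisymD)
    moreover have "pfun x \<in> Field a \<rightarrow>\<^sub>E Field b" "pfun y \<in> Field a \<rightarrow>\<^sub>E Field b"
      using * by (auto simp: hom_Pos_iff)
    ultimately have "pfun x = pfun y"
      by (intro PiE_ext)
    with * show "x = y" by (auto simp: hom_Pos_iff intro!: pmap.equality)
  qed
next
  case (4 f a b g c)
  then show ?case
    by (auto simp: hom_Pos_iff Pos_sel compose_def FieldI1 FieldI2)
next
  case (11 f a b f' g c)
  then show ?case
    by (auto simp: hom_Pos_iff Pos_sel compose_def)
next
  case (12 f a b g c g')
  then show ?case
    by (auto simp: hom_Pos_iff Pos_sel compose_def)
qed (auto simp: hom_Pos_iff Pos_sel monotone_maps_def FieldI1 FieldI2)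

lemma ordered_functor_fcomp:
  assumes "ordered_functor C E F" and "ordered_functor E G H"
  shows "ordered_functor C G (fcomp H F)"
proof -
  interpret F: ordered_functor C E F by fact
  interpret H: ordered_functor E G H by fact
  show ?thesis
    by unfold_locales
      (auto simp: fcomp_def F.ob_Obj H.ob_Obj F.mor_idn H.mor_idn
        F.mor_cmp H.mor_cmp[OF F.mor_hom F.mor_hom]
        intro: F.mor_hom H.mor_hom F.mor_mono H.mor_mono)
qed

end

theory Submission
  imports Defs
begin

text \<open>Given a diagram \<open>D\<close> in \<open>\<A>\<close>, let \<open>\<xi>\<close> be a weighted colimit of \<open>PD\<close> in \<open>\<X>\<close>. Any order-universal
  extension \<open>(\<alpha>, A, q)\<close> of \<open>\<xi>\<close> is a colimit of \<open>D\<close>. The reason is that the universal property of \<open>\<xi>\<close>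
  provides the data in \<open>\<X>\<close> that the universal property of the extension asks for.
  For a cocone \<open>\<beta>\<close> on \<open>D\<close>, a morphism \<open>f\<close> with \<open>f \<cdot> \<xi> = P\<beta>\<close> exists because \<open>P\<beta>\<close> is a
  cocone on \<open>PD\<close> (\<open>weighted_cocone_image\<close>), so the extension supplies \<open>t\<close> with \<open>t \<cdot> \<alpha> = \<beta>\<close>.
  And if \<open>r \<cdot> \<alpha> \<preceq> s \<cdot> \<alpha>\<close>, then applying \<open>P\<close> gives \<open>Pr \<cdot> q \<cdot> \<xi> \<preceq> Ps \<cdot> q \<cdot> \<xi>\<close>, whence
  \<open>Pr \<cdot> q \<preceq> Ps \<cdot> q\<close> as \<open>\<xi>\<close> is order-epic (\<open>extension_of_colimit_image_leq\<close>); so the extension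
  yields \<open>r \<preceq> s\<close>. Order-epicness in turn gives uniqueness of factorizations, by antisymmetry.\<close>

lemma weighted_coconeD:
  assumes "weighted_cocone \<D> W \<A> D \<alpha> A"
  shows "A \<in> Obj \<A>"
    and "\<lbrakk>i \<in> Obj \<D>; u \<in> Field (ob W i)\<rbrakk> \<Longrightarrow> \<alpha> i u \<in> hom \<A> (ob D i) A"
    and "\<lbrakk>i \<in> Obj \<D>; (u, v) \<in> ob W i\<rbrakk> \<Longrightarrow> \<alpha> i u \<preceq>\<^bsub>\<A>\<^esub> \<alpha> i v"
    and "\<lbrakk>i \<in> Obj \<D>; j \<in> Obj \<D>; d \<in> hom \<D> i j; v \<in> Field (ob W j)\<rbrakk>
      \<Longrightarrow> \<alpha> j v \<cdot>\<^bsub>\<A>\<^esub> mor D d = \<alpha> i (pfun (mor W d) v)"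
  using assms unfolding weighted_cocone_def by blast+

lemma weighted_cocone_image:
  assumes P: "ordered_functor \<A> \<X> P" and D: "ordered_functor \<D> \<A> D"
    and \<beta>: "weighted_cocone \<D> W \<A> D \<beta> B"
  shows "weighted_cocone \<D> W \<X> (fcomp P D) (image_cocone P \<beta>) (ob P B)"
proof -
  interpret P: ordered_functor \<A> \<X> P by fact
  interpret D: ordered_functor \<D> \<A> D by fact
  note \<beta> = weighted_coconeD[OF \<beta>]
  have "mor P (\<beta> i u) \<preceq>\<^bsub>\<X>\<^esub> mor P (\<beta> i v)" if "i \<in> Obj \<D>" "(u, v) \<in> ob W i" for i u v
    using that by (meson P.mor_mono \<beta>(2,3) FieldI1 FieldI2)
  moreover have "mor P (\<beta> j v) \<cdot>\<^bsub>\<X>\<^esub> mor P (mor D d) = mor P (\<beta> i (pfun (mor W d) v))"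
    if "i \<in> Obj \<D>" "j \<in> Obj \<D>" "d \<in> hom \<D> i j" "v \<in> Field (ob W j)" for i j d v
    using P.mor_cmp[OF D.mor_hom[OF that(3)] \<beta>(2)[OF that(2,4)]] \<beta>(4)[OF that] by simp
  ultimately show ?thesis
    unfolding weighted_cocone_def
    by (auto simp: fcomp_def image_cocone_def intro: P.ob_Obj P.mor_hom \<beta>)
qed

text \<open>Since \<open>q \<cdot> \<xi> = P\<alpha>\<close>, applying the monotone \<open>P\<close> to \<open>r \<cdot> \<alpha> \<preceq> s \<cdot> \<alpha>\<close> gives an inequality between
  composites with \<open>\<xi>\<close>, and \<open>\<xi>\<close> is order-epic. Hence, in the order condition of an
  extension of a colimit, the premise on \<open>q\<close> follows from the premise on \<open>\<alpha>\<close>.\<close>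

lemma extension_of_colimit_image_leq:
  assumes P: "ordered_functor \<A> \<X> P"
    and \<xi>: "weighted_colimit \<D> W \<X> (fcomp P D) \<xi> X"
    and \<alpha>: "weighted_cocone \<D> W \<A> D \<alpha> A"
    and q: "q \<in> hom \<X> X (ob P A)"
    and q\<xi>: "cocone_eq \<D> W (post \<X> q \<xi>) (image_cocone P \<alpha>)"
    and B: "B \<in> Obj \<A>" and r: "r \<in> hom \<A> A B" and s: "s \<in> hom \<A> A B"
    and rs: "cocone_leq \<D> W \<A> (post \<A> r \<alpha>) (post \<A> s \<alpha>)"
  shows "mor P r \<cdot>\<^bsub>\<X>\<^esub> q \<preceq>\<^bsub>\<X>\<^esub> mor P s \<cdot>\<^bsub>\<X>\<^esub> q"
proof -
  interpret P: ordered_functor \<A> \<X> P by fact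
  note \<alpha> = weighted_coconeD[OF \<alpha>]
  have \<xi>_cocone: "weighted_cocone \<D> W \<X> (fcomp P D) \<xi> X"
    using \<xi> unfolding weighted_colimit_def by blast
  have transfer: "(mor P t \<cdot>\<^bsub>\<X>\<^esub> q) \<cdot>\<^bsub>\<X>\<^esub> \<xi> i u = mor P (t \<cdot>\<^bsub>\<A>\<^esub> \<alpha> i u)"
    if "t \<in> hom \<A> A B" "i \<in> Obj \<D>" "u \<in> Field (ob W i)" for t i u
  proof -
    have "(mor P t \<cdot>\<^bsub>\<X>\<^esub> q) \<cdot>\<^bsub>\<X>\<^esub> \<xi> i u = mor P t \<cdot>\<^bsub>\<X>\<^esub> (q \<cdot>\<^bsub>\<X>\<^esub> \<xi> i u)"
      by (rule P.cod.cmp_assoc[OF weighted_coconeD(2)[OF \<xi>_cocone that(2,3)] q P.mor_hom[OF that(1)]])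
    also have "q \<cdot>\<^bsub>\<X>\<^esub> \<xi> i u = mor P (\<alpha> i u)"
      using q\<xi> that by (simp add: cocone_eq_def post_def image_cocone_def)
    also have "mor P t \<cdot>\<^bsub>\<X>\<^esub> mor P (\<alpha> i u) = mor P (t \<cdot>\<^bsub>\<A>\<^esub> \<alpha> i u)"
      by (rule P.mor_cmp[OF \<alpha>(2)[OF that(2,3)] that(1), symmetric])
    finally show ?thesis .
  qed
  have "mor P (r \<cdot>\<^bsub>\<A>\<^esub> \<alpha> i u) \<preceq>\<^bsub>\<X>\<^esub> mor P (s \<cdot>\<^bsub>\<A>\<^esub> \<alpha> i u)"
    if "i \<in> Obj \<D>" "u \<in> Field (ob W i)" for i u
    using rs that P.dom.cmp_hom[OF \<alpha>(2)[OF that]] r s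
    by (intro P.mor_mono) (auto simp: cocone_leq_def post_def)
  then have "cocone_leq \<D> W \<X> (post \<X> (mor P r \<cdot>\<^bsub>\<X>\<^esub> q) \<xi>) (post \<X> (mor P s \<cdot>\<^bsub>\<X>\<^esub> q) \<xi>)"
    by (simp add: cocone_leq_def post_def transfer r s)
  moreover have "mor P r \<cdot>\<^bsub>\<X>\<^esub> q \<in> hom \<X> X (ob P B)" "mor P s \<cdot>\<^bsub>\<X>\<^esub> q \<in> hom \<X> X (ob P B)"
    using r s by (auto intro: P.cod.cmp_hom[OF q] P.mor_hom)
  ultimately show ?thesis
    using \<xi> P.ob_Obj[OF B] unfolding weighted_colimit_def by blast
qed

text \<open>Antisymmetry makes the uniqueness of factorizations a consequence of order-epicness, so that only
  their existence has to be checked.\<close>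

lemma weighted_colimitI:
  assumes \<A>: "ordered_category \<A>" and \<alpha>: "weighted_cocone \<D> W \<A> D \<alpha> A"
    and factor: "\<And>\<beta> B. weighted_cocone \<D> W \<A> D \<beta> B \<Longrightarrow>
      \<exists>t \<in> hom \<A> A B. cocone_eq \<D> W \<beta> (post \<A> t \<alpha>)"
    and order_epic: "\<And>B r s. \<lbrakk>B \<in> Obj \<A>; r \<in> hom \<A> A B; s \<in> hom \<A> A B;
      cocone_leq \<D> W \<A> (post \<A> r \<alpha>) (post \<A> s \<alpha>)\<rbrakk> \<Longrightarrow> r \<preceq>\<^bsub>\<A>\<^esub> s"
  shows "weighted_colimit \<D> W \<A> D \<alpha> A"
proof -
  interpret ordered_category \<A> by fact
  have leq: "cocone_leq \<D> W \<A> (post \<A> r \<alpha>) (post \<A> s \<alpha>)"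
    if "r \<in> hom \<A> A B" "cocone_eq \<D> W \<beta> (post \<A> r \<alpha>)" "cocone_eq \<D> W \<beta> (post \<A> s \<alpha>)" for \<beta> B r s
    unfolding cocone_leq_def
  proof (intro ballI)
    fix i u assume iu: "i \<in> Obj \<D>" "u \<in> Field (ob W i)"
    then have "post \<A> r \<alpha> i u = post \<A> s \<alpha> i u"
      using that by (simp add: cocone_eq_def)
    moreover have "post \<A> r \<alpha> i u \<in> hom \<A> (ob D i) B"
      unfolding post_def by (rule cmp_hom[OF weighted_coconeD(2)[OF \<alpha> iu] that(1)])
    ultimately show "post \<A> r \<alpha> i u \<preceq>\<^bsub>\<A>\<^esub> post \<A> s \<alpha> i u"
      using reflp_onD[OF leq_refl] by metis
  qed
  have "r = s" if "weighted_cocone \<D> W \<A> D \<beta> B" "r \<in> hom \<A> A B" "s \<in> hom \<A> A B"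
    "cocone_eq \<D> W \<beta> (post \<A> r \<alpha>)" "cocone_eq \<D> W \<beta> (post \<A> s \<alpha>)" for \<beta> B r s
    using order_epic leq that weighted_coconeD(1)[OF that(1)]
    by (blast intro: antisymp_onD[OF leq_antisym])
  with \<alpha> factor order_epic show ?thesis
    unfolding weighted_colimit_def by blast
qed

lemma weighted_colimit_of_universal_extension:
  assumes P: "ordered_functor \<A> \<X> P" and D: "ordered_functor \<D> \<A> D"
    and \<xi>: "weighted_colimit \<D> W \<X> (fcomp P D) \<xi> X"
    and ext: "order_universal_extension \<D> W \<A> \<X> P D \<xi> X \<alpha> A q"
  shows "weighted_colimit \<D> W \<A> D \<alpha> A"
proof (rule weighted_colimitI)
  show "ordered_category \<A>"
    using P by (simp add: ordered_functor_def)
  show \<alpha>: "weighted_cocone \<D> W \<A> D \<alpha> A"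
    using ext unfolding order_universal_extension_def by blast
  show "\<exists>t \<in> hom \<A> A B. cocone_eq \<D> W \<beta> (post \<A> t \<alpha>)"
    if \<beta>: "weighted_cocone \<D> W \<A> D \<beta> B" for \<beta> B
  proof -
    obtain f where f: "f \<in> hom \<X> X (ob P B)" "cocone_eq \<D> W (image_cocone P \<beta>) (post \<X> f \<xi>)"
      using \<xi> weighted_cocone_image[OF P D \<beta>] unfolding weighted_colimit_def by blast
    have "cocone_eq \<D> W (post \<X> f \<xi>) (image_cocone P \<beta>)"
      using f(2) by (simp add: cocone_eq_def)
    then obtain t where "t \<in> hom \<A> A B" "cocone_eq \<D> W (post \<A> t \<alpha>) \<beta>"
      using ext f(1) \<beta> unfolding order_universal_extension_def by blast
    then show ?thesis
      by (intro bexI[of _ t]) (simp_all add: cocone_eq_def)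
  qed
  show "r \<preceq>\<^bsub>\<A>\<^esub> s"
    if *: "B \<in> Obj \<A>" "r \<in> hom \<A> A B" "s \<in> hom \<A> A B"
      "cocone_leq \<D> W \<A> (post \<A> r \<alpha>) (post \<A> s \<alpha>)" for B r s
  proof -
    have "q \<in> hom \<X> X (ob P A)" "cocone_eq \<D> W (post \<X> q \<xi>) (image_cocone P \<alpha>)"
      using ext unfolding order_universal_extension_def by blast+
    then have "mor P r \<cdot>\<^bsub>\<X>\<^esub> q \<preceq>\<^bsub>\<X>\<^esub> mor P s \<cdot>\<^bsub>\<X>\<^esub> q"
      using extension_of_colimit_image_leq[OF P \<xi> \<alpha>] * by blast
    with * ext show ?thesis
      unfolding order_universal_extension_def by blast
  qed
qed

theorem corollary5p3:
  fixes \<A> :: "('o, 'a) ocat" and \<X> :: "('p, 'b) ocat"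
    and P :: "('o, 'a, 'p, 'b) fctr" and \<D> :: "('i, 'd) ocat"
  assumes "ordered_category \<A>" and "ordered_category \<X>"
    and "ordered_functor \<A> \<X> P"
    and "order_solid TYPE('i) TYPE('d) TYPE('w) \<A> \<X> P"
    and "ordered_category \<D>"
    and "has_weighted_colimits_of_shape TYPE('w) \<D> \<X>"
  shows "has_weighted_colimits_of_shape TYPE('w) \<D> \<A>"
  unfolding has_weighted_colimits_of_shape_def
proof (intro allI impI)
  fix D and W :: "('i, 'd, 'w) weight"
  assume D: "ordered_functor \<D> \<A> D" and W: "is_weight \<D> W"
  obtain \<xi> X where \<xi>: "weighted_colimit \<D> W \<X> (fcomp P D) \<xi> X"
    using assms(6) ordered_functor_fcomp[OF D assms(3)] W
    unfolding has_weighted_colimits_of_shape_def by blast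
  then have "weighted_cocone \<D> W \<X> (fcomp P D) \<xi> X"
    unfolding weighted_colimit_def by blast
  then obtain \<alpha> A q where "order_universal_extension \<D> W \<A> \<X> P D \<xi> X \<alpha> A q"
    using assms(4,5) D W unfolding order_solid_def by blast
  then show "\<exists>\<alpha> A. weighted_colimit \<D> W \<A> D \<alpha> A"
    using weighted_colimit_of_universal_extension[OF assms(3) D \<xi>] by blast
qed

end
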